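(* Let $f(z)=\sum_{k=1}^\infty A_k'z^k$ and $g(z)=\sum_{k=1}^\infty A_kz^k$. The analytic function $f(z)$ has a singularity at $z=1/2$, and the radius of convergence of its power series at the origin equals $1/2$. Other than $z=1/2$, the singularities of $f(z)$ coincide with those of $g(z^2)$, and $f(z)(z-1/2)$ is continuous on $|z|\le1/2$.
   Context: All intervals are intervals of integers. For $k\ge1$, an ordered pair $(L,M)$ of subsets of $(0,k)$ is admissible if $L\subseteq M$ and for every $x\in M$ there exists $y\in L$ with $x+y\le k$ and $x+y\notin M$. $A_k$ is the number of admissible ordered pairs of subsets of $(0,k)$, and $A_k'$ is the number of subsets $L\subseteq(0,k)$ for which $(L,L)$ is admissible. Conventions: $f(z)$ and $g(z^2)$ are regarded as analytic functions given by their power series near $0$ together with analytic continuation. A singularity of $f$ at a point on the boundary of its disc of convergence means that $f$ does not extend analytically to a neighborhood of that point. "Other than $1/2$ the singularities coincide" means: for every connected open set $U\subseteq\mathbb C$ with $0\in U$ and $1/2\notin U$, the germ at $0$ of $f(z)$ extends to an analytic function on $U$ if and only if the germ at $0$ of $g(z^2)$ does. "Continuous on $|z|\le1/2$" means that $f(z)(z-1/2)$, defined for $|z|<1/2$, extends continuously to the closed disc. *)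

theory Defs
  imports "HOL-Analysis.Analysis"
begin

definition admissible :: "nat \<Rightarrow> nat set \<Rightarrow> nat set \<Rightarrow> bool" where
  "admissible k L M \<longleftrightarrow>
     L \<subseteq> {0<..<k} \<and> M \<subseteq> {0<..<k} \<and> L \<subseteq> M \<and>
     (\<forall>x\<in>M. \<exists>y\<in>L. x + y \<le> k \<and> x + y \<notin> M)"

definition num_pairs :: "nat \<Rightarrow> nat" where
  "num_pairs k = card {(L, M). admissible k L M}"

definition num_diag :: "nat \<Rightarrow> nat" where
  "num_diag k = card {L. admissible k L L}"

text \<open>Both series start at \<open>k = 1\<close>; the definitions above would give the value 1 at
  \<open>k = 0\<close>, so the constant term is set to 0 explicitly.\<close>

definition f_series :: "complex fps" where
  "f_series = Abs_fps (\<lambda>k. if k = 0 then 0 else of_nat (num_diag k))"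

definition g_series :: "complex fps" where
  "g_series = Abs_fps (\<lambda>k. if k = 0 then 0 else of_nat (num_pairs k))"

definition boundary_singularity :: "complex fps \<Rightarrow> complex \<Rightarrow> bool" where
  "boundary_singularity F p \<longleftrightarrow>
     ereal (norm p) = fps_conv_radius F \<and>
     \<not> (\<exists>V h. open V \<and> p \<in> V \<and> h analytic_on V \<and>
          (\<forall>z \<in> V \<inter> eball 0 (fps_conv_radius F). h z = eval_fps F z))"

text \<open>Only the values of \<open>\<phi>\<close> near 0 matter here, so the (meaningless) values of
  \<^const>\<open>eval_fps\<close> outside the disc of convergence play no role.\<close>

definition germ_extends_to :: "(complex \<Rightarrow> complex) \<Rightarrow> complex set \<Rightarrow> bool" where
  "germ_extends_to \<phi> U \<longleftrightarrow>
     (\<exists>h. h analytic_on U \<and> (\<forall>\<^sub>F z in nhds 0. h z = \<phi> z))"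

end

theory Submission
  imports Defs "HOL-Complex_Analysis.Laurent_Convergence"
begin

text \<open>Whether \<open>(L, L)\<close> is admissible depends only on the elements of \<open>L\<close> above \<open>k / 2\<close>, and their
  conditions only involve elements below \<open>k / 2\<close>. Hence the middle element is free for even \<open>k\<close>, and
  passing from \<open>2m - 1\<close> to \<open>2m + 1\<close> adds a small and a large element, where the extensions that fail
  correspond to the admissible pairs of subsets of \<open>(0, m)\<close>:
  \<open>A'\<^sub>k\<^sub>+\<^sub>1 = 2 A'\<^sub>k\<close> for odd \<open>k\<close> and \<open>A'\<^sub>k\<^sub>+\<^sub>1 = 2 A'\<^sub>k - A\<^sub>m\<close> for \<open>k = 2m\<close>. So
  \<open>(1 - 2 z) f(z) = z (1 - g(z\<^sup>2))\<close>. Since \<open>A\<^sub>k \<le> 3\<^sup>k\<^sup>-\<^sup>1\<close>, strictly for \<open>k = 2\<close>, the series \<open>g\<close> has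
  radius of convergence at least \<open>1/3 > 1/4\<close> and \<open>g(1/4) < 1\<close>, so the pole at \<open>1/2\<close> does not cancel.\<close>

section \<open>Symmetric pairs and their encoding by small and large elements\<close>

text \<open>An element that violates the condition makes \<open>L\<close> closed under adding it, so its largest
  multiple up to \<open>k\<close>, which exceeds \<open>k / 2\<close>, violates the condition as well.\<close>

lemma admissible_diag_iff:
  "admissible k L L \<longleftrightarrow>
     L \<subseteq> {0<..<k} \<and> (\<forall>x\<in>L. k < 2 * x \<longrightarrow> (\<exists>y\<in>L. x + y \<le> k \<and> x + y \<notin> L))"
proof
  assume R: "L \<subseteq> {0<..<k} \<and> (\<forall>x\<in>L. k < 2 * x \<longrightarrow> (\<exists>y\<in>L. x + y \<le> k \<and> x + y \<notin> L))"
  have "\<exists>y\<in>L. x + y \<le> k \<and> x + y \<notin> L" if x: "x \<in> L" for x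
  proof (rule ccontr)
    assume "\<not> ?thesis"
    then have step: "x + y \<in> L" if "y \<in> L" "x + y \<le> k" for y using that by blast
    have closed: "y + j * x \<in> L" if "y \<in> L" "y + j * x \<le> k" for y j
      using that
    proof (induction j)
      case (Suc j)
      then show ?case using step[of "y + j * x"] by (simp add: add.left_commute)
    qed simp
    define q where "q = k div x"
    have "0 < x" "x < k" using R x by auto
    then have "0 < q" by (simp add: q_def div_greater_zero_iff)
    have "k < q * x + x" "q * x \<le> k"
      using \<open>0 < x\<close> dividend_less_div_times[of x k] by (simp_all add: q_def add.commute)
    moreover have "x \<le> q * x" using \<open>0 < q\<close> by simp
    ultimately have "k < 2 * (q * x)" by linarith
    moreover have "q * x \<in> L"
      using closed[OF x, of "q - 1"] \<open>0 < q\<close> \<open>q * x \<le> k\<close> by (cases q) auto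
    ultimately obtain y where "y \<in> L" "q * x + y \<le> k" "q * x + y \<notin> L"
      using R by blast
    \<comment> \<open>The witness \<open>y\<close> for \<open>q * x\<close> lies in \<open>L\<close>
      itself, so adding \<open>x\<close> to it \<open>q\<close> times stays in
      \<open>L\<close>.\<close>
    then show False using closed[of y q] by (simp add: add.commute)
  qed
  then show "admissible k L L" using R by (auto simp: admissible_def)
qed (auto simp: admissible_def)

text \<open>\<open>S\<close> encodes the elements of \<open>L\<close> below \<open>k / 2\<close>, and \<open>U\<close> those above it through
  \<open>u = k - x\<close>; the truncated subtraction is harmless because of the guard \<open>y \<le> u\<close>.\<close>

definition good_pairs :: "nat \<Rightarrow> (nat set \<times> nat set) set" where
  "good_pairs m = {(S, U) \<in> Pow {1..m} \<times> Pow {1..m}. \<forall>u\<in>U. \<exists>y\<in>S. y \<le> u \<and> u - y \<notin> U}"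

lemma finite_good_pairs [simp]: "finite (good_pairs m)"
  by (rule finite_subset[of _ "Pow {1..m} \<times> Pow {1..m}"]) (auto simp: good_pairs_def)

text \<open>For \<open>x\<close> above \<open>k / 2\<close> and \<open>u = k - x\<close>, a witness
  \<open>y\<close> satisfies \<open>y \<le> u \<le> m\<close>, and
  \<open>x + y = k - (u - y)\<close> turns \<open>x + y \<notin> L\<close> into
  \<open>u - y \<notin> U\<close>. A middle element \<open>m + 1\<close> exists only for
  \<open>e = 1\<close>, that is, for even \<open>k\<close>.\<close>

lemma bij_betw_admissible_diag:
  assumes k: "k = 2 * m + 1 + e" and e: "e \<le> 1"
  shows "bij_betw (\<lambda>L. ((L \<inter> {1..m}, {u \<in> {1..m}. k - u \<in> L}), L \<inter> {m+1..m+e}))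
           {L. admissible k L L} (good_pairs m \<times> Pow {m+1..m+e})"
    (is "bij_betw ?F _ _")
proof -
  let ?B = "(Pow {1..m} \<times> Pow {1..m}) \<times> Pow {m+1..m+e}"
  have bij: "bij_betw ?F (Pow {0<..<k}) ?B"
  proof (rule bij_betw_byWitness[where f' = "\<lambda>((S, U), E). S \<union> (\<lambda>u. k - u) ` U \<union> E"])
    show "\<forall>L\<in>Pow {0<..<k}. (\<lambda>((S, U), E). S \<union> (\<lambda>u. k - u) ` U \<union> E) (?F L) = L"
    proof
      fix L assume L: "L \<in> Pow {0<..<k}"
      have "x \<in> L \<inter> {1..m} \<union> (\<lambda>u. k - u) ` {u \<in> {1..m}. k - u \<in> L} \<union> L \<inter> {m+1..m+e}"
        if "x \<in> L" for x
      proof -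
        have "x = k - (k - x)" "0 < x" "x < k" using L that by auto
        show ?thesis
        proof (cases "m + e < x")
          case True
          then have "k - x \<in> {u \<in> {1..m}. k - u \<in> L}"
            using \<open>x < k\<close> \<open>x \<in> L\<close> k by auto
          then show ?thesis using \<open>x = k - (k - x)\<close> by blast
        qed (use that \<open>0 < x\<close> in auto)
      qed
      then have "L \<inter> {1..m} \<union> (\<lambda>u. k - u) ` {u \<in> {1..m}. k - u \<in> L} \<union> L \<inter> {m+1..m+e} = L"
        by blast
      then show "(\<lambda>((S, U), E). S \<union> (\<lambda>u. k - u) ` U \<union> E) (?F L) = L" by simp
    qed
    show "\<forall>b\<in>?B. ?F ((\<lambda>((S, U), E). S \<union> (\<lambda>u. k - u) ` U \<union> E) b) = b"
    proof (clarsimp, goal_cases)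
      case (1 S U E)
      have S: "1 \<le> x" "x \<le> m" if "x \<in> S" for x using that 1 by auto
      have U: "1 \<le> x" "x \<le> m" if "x \<in> U" for x using that 1 by auto
      have E: "m < x" "x \<le> m + e" if "x \<in> E" for x using that 1 by auto
      \<comment> \<open>Reflection sends \<open>{1..m}\<close> onto the elements between
        \<open>m + e\<close> and \<open>k\<close>, so \<open>S\<close>, \<open>E\<close> and the
        reflected \<open>U\<close> occupy disjoint ranges.\<close>
      have reflect: "x \<in> (\<lambda>u. k - u) ` U \<longleftrightarrow> m + e < x \<and> x < k \<and> k - x \<in> U" for x
      proof
        assume "x \<in> (\<lambda>u. k - u) ` U"
        then obtain u where u: "u \<in> U" "x = k - u" by auto
        then show "m + e < x \<and> x < k \<and> k - x \<in> U" using U[of u] k by auto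
      next
        assume x: "m + e < x \<and> x < k \<and> k - x \<in> U"
        then have "x = k - (k - x)" by auto
        then show "x \<in> (\<lambda>u. k - u) ` U" using x by blast
      qed
      let ?L = "S \<union> (\<lambda>u. k - u) ` U \<union> E"
      have "x \<in> ?L \<inter> {Suc 0..m} \<longleftrightarrow> x \<in> S" for x
        using S[of x] E[of x] reflect[of x] by auto
      moreover have "Suc 0 \<le> u \<and> u \<le> m \<and> (k - u \<in> S \<or> k - u \<in> (\<lambda>u. k - u) ` U \<or> k - u \<in> E) \<longleftrightarrow> u \<in> U"
        (is "?lhs u \<longleftrightarrow> _") for u
      proof (cases "Suc 0 \<le> u \<and> u \<le> m")
        case True
        then have "k - (k - u) = u" "m + e < k - u" "k - u < k" using k by auto
        then show ?thesis using True S[of "k - u"] E[of "k - u"] reflect[of "k - u"] by auto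
      qed (use U[of u] in auto)
      moreover have "x \<in> ?L \<inter> {Suc m..m + e} \<longleftrightarrow> x \<in> E" for x
        using S[of x] E[of x] reflect[of x] by auto
      ultimately show ?case by (intro conjI set_eqI) simp_all
    qed
    show "?F ` Pow {0<..<k} \<subseteq> ?B" by auto
    show "(\<lambda>((S, U), E). S \<union> (\<lambda>u. k - u) ` U \<union> E) ` ?B \<subseteq> Pow {0<..<k}"
    proof (clarsimp, goal_cases)
      case (1 S U E x)
      then show ?case using k by auto
    qed
  qed
  have iff: "(\<forall>u\<in>{u \<in> {1..m}. k - u \<in> L}. \<exists>y\<in>L \<inter> {1..m}. y \<le> u \<and> u - y \<notin> {u \<in> {1..m}. k - u \<in> L})
      \<longleftrightarrow> (\<forall>x\<in>L. k < 2 * x \<longrightarrow> (\<exists>y\<in>L. x + y \<le> k \<and> x + y \<notin> L))" (is "?l \<longleftrightarrow> ?r")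
    if L: "L \<in> Pow {0<..<k}" for L
  proof
    assume l: ?l
    show ?r
    proof (intro ballI impI)
      fix x assume x: "x \<in> L" "k < 2 * x"
      then have "x < k" using L by auto
      then have "k - x \<in> {u \<in> {1..m}. k - u \<in> L}" using x k e by auto
      from bspec[OF l this] obtain y
        where y: "y \<in> L" "1 \<le> y" "y \<le> k - x" "k - x - y \<notin> {u \<in> {1..m}. k - u \<in> L}"
        by auto
      have "x + y \<notin> L"
      proof
        assume "x + y \<in> L"
        \<comment> \<open>As \<open>k\<close> lies outside \<open>L\<close>, the inequality is
          strict, so \<open>k - x - y\<close> is at least 1 and falls into the encoded set.\<close>
        moreover from this have "x + y < k" using L by auto
        moreover have "k - (k - x - y) = x + y" using calculation by simp
        ultimately show False using y x k e by auto
      qed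
      then show "\<exists>y\<in>L. x + y \<le> k \<and> x + y \<notin> L" using y \<open>x < k\<close> by (intro bexI[of _ y]) auto
    qed
  next
    assume r: ?r
    show ?l
    proof
      fix u assume u: "u \<in> {u \<in> {1..m}. k - u \<in> L}"
      then have "k - u \<in> L" "k < 2 * (k - u)" using k by auto
      with r obtain y where y: "y \<in> L" "k - u + y \<le> k" "k - u + y \<notin> L" by blast
      have "0 < y" using y L by auto
      moreover have "y \<le> u" using y u k by auto
      moreover have "k - (u - y) = k - u + y" using \<open>y \<le> u\<close> u k by auto
      then have "u - y \<notin> {u \<in> {1..m}. k - u \<in> L}" using y by simp
      moreover have "y \<in> L \<inter> {1..m}" using y u calculation by simp
      ultimately show "\<exists>y\<in>L \<inter> {1..m}. y \<le> u \<and> u - y \<notin> {u \<in> {1..m}. k - u \<in> L}"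
        by blast
    qed
  qed
  have "bij_betw ?F {L \<in> Pow {0<..<k}. \<forall>x\<in>L. k < 2 * x \<longrightarrow> (\<exists>y\<in>L. x + y \<le> k \<and> x + y \<notin> L)}
          {b \<in> ?B. case b of ((S, U), E) \<Rightarrow> \<forall>u\<in>U. \<exists>y\<in>S. y \<le> u \<and> u - y \<notin> U}"
    using bij by (rule bij_betw_Collect) (use iff in simp)
  moreover have "{L \<in> Pow {0<..<k}. \<forall>x\<in>L. k < 2 * x \<longrightarrow> (\<exists>y\<in>L. x + y \<le> k \<and> x + y \<notin> L)}
      = {L. admissible k L L}"
    by (auto simp: admissible_diag_iff)
  moreover have "{b \<in> ?B. case b of ((S, U), E) \<Rightarrow> \<forall>u\<in>U. \<exists>y\<in>S. y \<le> u \<and> u - y \<notin> U}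
      = good_pairs m \<times> Pow {m+1..m+e}"
    by (auto simp: good_pairs_def)
  ultimately show ?thesis by simp
qed

lemma num_diag_eq:
  assumes "e \<le> 1"
  shows "num_diag (2 * m + 1 + e) = card (good_pairs m) * 2 ^ e"
  using bij_betw_same_card[OF bij_betw_admissible_diag[OF refl assms, of m]]
  by (simp add: num_diag_def card_cartesian_product card_Pow)

section \<open>The recurrence linking the two counting sequences\<close>

text \<open>If only \<open>u = n\<close> can fail, and does, then \<open>S\<close> is contained in the reflection \<open>M\<close> of
  \<open>U - {n}\<close>, and the conditions at the other \<open>u\<close> say that \<open>(S, M)\<close> is admissible.\<close>

lemma bij_betw_failing_pairs:
  assumes n: "n = Suc m"
  shows "bij_betw (\<lambda>(S, U). (S, {x \<in> {0<..<n}. n - x \<in> U}))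
     {(S, U) \<in> Pow {1..n} \<times> Pow {1..n}.
        (\<forall>u\<in>U \<inter> {1..m}. \<exists>y\<in>S. y \<le> u \<and> u - y \<notin> U) \<and>
        \<not> (\<forall>u\<in>U. \<exists>y\<in>S. y \<le> u \<and> u - y \<notin> U)}
     {(L, M). admissible n L M}"
\<comment> \<open>The inserted \<open>0\<close> reflects to \<open>n\<close>, which always belongs
  to \<open>U\<close> in a failing pair and is discarded by the passage to \<open>M\<close>.\<close>
proof (rule bij_betw_byWitness[where f' = "\<lambda>(L, M). (L, (\<lambda>x. n - x) ` insert 0 M)"], goal_cases)
  case 1
  show ?case
  proof (clarsimp, goal_cases)
    case (1 S U u)
    \<comment> \<open>The failing \<open>u\<close> lies outside \<open>{1..m}\<close>, where all
      conditions are assumed.\<close>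
    then have "n \<in> U" "u = n"
      using n by (metis IntI atLeastAtMost_iff le_SucE subsetD)+
    have "(\<lambda>x. n - x) ` insert 0 {x. 0 < x \<and> x < n \<and> n - x \<in> U} = U" (is "?l = _")
    proof
      show "U \<subseteq> ?l"
      proof
        fix v assume "v \<in> U"
        moreover from this have "0 < v" "v \<le> n" using 1 by auto
        ultimately show "v \<in> ?l"
          by (intro image_eqI[of _ _ "n - v"]) auto
      qed
    qed (use \<open>n \<in> U\<close> in auto)
    then show ?case by simp
  qed
next
  case 2
  show ?case
  proof (clarsimp, goal_cases)
    case (1 L M)
    then have M: "M \<subseteq> {0<..<n}" by (simp add: admissible_def)
    have "x \<in> M" if "0 < x" "x < n" "n - x \<in> insert n ((-) n ` M)" for x
    proof -
      from that obtain z where "z \<in> M" "n - x = n - z" by auto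
      moreover from this have "z = x" using M that by auto
      ultimately show ?thesis by simp
    qed
    then show ?case using M by auto
  qed
next
  case 3
  show ?case
  proof (clarsimp, goal_cases)
    case (1 S U u)
    then have "n \<in> U" "u = n"
      using n by (metis IntI atLeastAtMost_iff le_SucE subsetD)+
    let ?M = "{x \<in> {0<..<n}. n - x \<in> U}"
    \<comment> \<open>Failure at \<open>n\<close> forces \<open>n - x\<close> into \<open>U\<close>
      for every \<open>x\<close> in \<open>S\<close>; as \<open>0\<close> is not in
      \<open>U\<close>, this excludes \<open>x = n\<close>.\<close>
    have S: "x < n \<and> n - x \<in> U" if "x \<in> S" for x
    proof -
      have "0 < x" "x \<le> n" using that 1 by auto
      then have "n - x \<in> U" using 1 that \<open>u = n\<close> by auto
      moreover from this have "0 < n - x" using 1 by fastforce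
      ultimately show ?thesis by simp
    qed
    have small: "\<forall>u\<in>U \<inter> {1..m}. \<exists>y\<in>S. y \<le> u \<and> u - y \<notin> U" using 1 by simp
    have "\<exists>y\<in>S. x + y \<le> n \<and> (x + y < n \<longrightarrow> n - (x + y) \<notin> U)"
      if x: "0 < x" "x < n" "n - x \<in> U" for x
    proof -
      have "n - x \<in> U \<inter> {1..m}" using x n by auto
      from bspec[OF small this] obtain y where "y \<in> S" "y \<le> n - x" "n - x - y \<notin> U" by blast
      then show ?thesis using x by (intro bexI[of _ y]) auto
    qed
    then have "\<forall>x\<in>?M. \<exists>y\<in>S. x + y \<le> n \<and> x + y \<notin> ?M" by auto
    moreover have "S \<subseteq> ?M" using S 1 by auto
    ultimately have "admissible n S ?M" unfolding admissible_def by blast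
    then show ?case by simp
  qed
next
  case 4
  show ?case
  proof (clarsimp, goal_cases)
    case (1 L M)
    then have LM: "L \<subseteq> M" "M \<subseteq> {0<..<n}" "\<And>x. x \<in> M \<Longrightarrow> \<exists>y\<in>L. x + y \<le> n \<and> x + y \<notin> M"
      by (auto simp: admissible_def)
    have good: "\<exists>y\<in>L. y \<le> n - x \<and> n - x - y \<noteq> n \<and> n - x - y \<notin> (-) n ` M" if x: "x \<in> M" for x
    proof -
      obtain y where y: "y \<in> L" "x + y \<le> n" "x + y \<notin> M" using LM(3)[OF x] by blast
      have "0 < x" using x LM by auto
      moreover have "n - x - y \<notin> (-) n ` M"
      proof
        assume "n - x - y \<in> (-) n ` M"
        then obtain z where "z \<in> M" "n - x - y = n - z" by auto
        moreover from this have "z < n" using LM by auto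
        ultimately have "z = x + y" using y by auto
        then show False using y \<open>z \<in> M\<close> by simp
      qed
      ultimately show ?thesis using y by (intro bexI[of _ y]) auto
    qed
    \<comment> \<open>This is the failure at \<open>n\<close>, a consequence of
      \<open>L \<subseteq> M\<close>.\<close>
    have "n - y \<in> (-) n ` M" if "y \<in> L" for y using that LM by auto
    moreover have "L \<subseteq> {Suc 0..n}" using LM by fastforce
    moreover have "(-) n ` M \<subseteq> {Suc 0..n}"
    proof (rule image_subsetI)
      fix x assume "x \<in> M"
      then have "x < n" using LM by auto
      then show "n - x \<in> {Suc 0..n}" by simp
    qed
    moreover have "\<exists>y\<in>L. y \<le> u \<and> u - y \<noteq> n \<and> u - y \<notin> (-) n ` M"
      if u: "u \<in> insert n ((-) n ` M) \<inter> {Suc 0..m}" for u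
    proof -
      obtain x where "x \<in> M" "u = n - x" using u n by auto
      then show ?thesis using good by simp
    qed
    ultimately show ?case using n by simp
  qed
qed

text \<open>A condition at \<open>u \<le> m\<close> only tests \<open>y \<le> u\<close> and
  \<open>u - y\<close>, all at most \<open>m\<close>, so membership of \<open>n\<close> in
  \<open>S\<close> and in \<open>U\<close> can be chosen freely, in four ways.\<close>

lemma bij_betw_restrict:
  assumes n: "n = Suc m"
  shows "bij_betw (\<lambda>(S, U). ((S \<inter> {1..m}, U \<inter> {1..m}), (S \<inter> {n}, U \<inter> {n})))
     {(S, U) \<in> Pow {1..n} \<times> Pow {1..n}. \<forall>u\<in>U \<inter> {1..m}. \<exists>y\<in>S. y \<le> u \<and> u - y \<notin> U}
     (good_pairs m \<times> Pow {n} \<times> Pow {n})"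
    (is "bij_betw ?F _ _")
proof -
  let ?A = "Pow {1..n} \<times> Pow {1..n}" and ?B = "(Pow {1..m} \<times> Pow {1..m}) \<times> Pow {n} \<times> Pow {n}"
  have bij: "bij_betw (\<lambda>(S, U). ((S \<inter> X, U \<inter> X), (S \<inter> {n}, U \<inter> {n})))
      (Pow (insert n X) \<times> Pow (insert n X)) ((Pow X \<times> Pow X) \<times> Pow {n} \<times> Pow {n})"
    if "n \<notin> X" for X
    by (rule bij_betw_byWitness[where f' = "\<lambda>((S, U), (S', U')). (S \<union> S', U \<union> U')"])
      (use that in \<open>clarsimp; blast\<close>)+
  have "{1..n} = insert n {1..m}" using n by auto
  with bij[of "{1..m}"] n have "bij_betw ?F ?A ?B" by simp
  then have "bij_betw ?F {x \<in> ?A. case x of (S, U) \<Rightarrow> \<forall>u\<in>U \<inter> {1..m}. \<exists>y\<in>S. y \<le> u \<and> u - y \<notin> U}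
     {x \<in> ?B. case x of ((S, U), _) \<Rightarrow> \<forall>u\<in>U. \<exists>y\<in>S. y \<le> u \<and> u - y \<notin> U}"
  proof (rule bij_betw_Collect, clarsimp, goal_cases)
    case (1 S U)
    \<comment> \<open>All members are positive, so \<open>u - y = 0\<close> is outside
      \<open>U\<close> both before and after the restriction to \<open>{1..m}\<close>.\<close>
    have range: "Suc 0 \<le> v" if "v \<in> S \<union> U" for v using that 1 by auto
    have "(y \<in> S \<inter> {Suc 0..m} \<and> y \<le> u \<and> (Suc 0 \<le> u - y \<longrightarrow> u - y \<in> U \<longrightarrow> \<not> u - y \<le> m))
        \<longleftrightarrow> (y \<in> S \<and> y \<le> u \<and> u - y \<notin> U)" if "u \<le> m" for u y
      using that range[of y] range[of "u - y"] by auto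
    then have "(\<exists>y\<in>S \<inter> {Suc 0..m}. y \<le> u \<and> (Suc 0 \<le> u - y \<longrightarrow> u - y \<in> U \<longrightarrow> \<not> u - y \<le> m))
        \<longleftrightarrow> (\<exists>y\<in>S. y \<le> u \<and> u - y \<notin> U)" if "u \<le> m" for u
      using that by (simp only: Bex_def)
    then show ?case by (intro ball_cong refl) simp
  qed
  moreover have "{x \<in> ?B. case x of ((S, U), _) \<Rightarrow> \<forall>u\<in>U. \<exists>y\<in>S. y \<le> u \<and> u - y \<notin> U}
      = good_pairs m \<times> Pow {n} \<times> Pow {n}"
    by (auto simp: good_pairs_def)
  moreover have "{x \<in> ?A. case x of (S, U) \<Rightarrow> \<forall>u\<in>U \<inter> {1..m}. \<exists>y\<in>S. y \<le> u \<and> u - y \<notin> U}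
    = {(S, U) \<in> Pow {1..n} \<times> Pow {1..n}. \<forall>u\<in>U \<inter> {1..m}. \<exists>y\<in>S. y \<le> u \<and> u - y \<notin> U}"
    by auto
  ultimately show ?thesis by simp
qed

text \<open>The four extensions of each good pair for \<open>m\<close> are either good for
  \<open>Suc m\<close> or fail exactly at \<open>Suc m\<close>, and the failing ones correspond to
  admissible pairs. A sum avoids truncated subtraction.\<close>

lemma card_good_pairs_Suc: "card (good_pairs (Suc m)) + num_pairs (Suc m) = 4 * card (good_pairs m)"
proof -
  let ?T = "{(S, U) \<in> Pow {1..Suc m} \<times> Pow {1..Suc m}. \<forall>u\<in>U \<inter> {1..m}. \<exists>y\<in>S. y \<le> u \<and> u - y \<notin> U}"
  let ?B = "{(S, U) \<in> Pow {1..Suc m} \<times> Pow {1..Suc m}.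
        (\<forall>u\<in>U \<inter> {1..m}. \<exists>y\<in>S. y \<le> u \<and> u - y \<notin> U) \<and>
        \<not> (\<forall>u\<in>U. \<exists>y\<in>S. y \<le> u \<and> u - y \<notin> U)}"
  have "card ?B = num_pairs (Suc m)"
    using bij_betw_same_card[OF bij_betw_failing_pairs[OF refl, of m]] by (simp add: num_pairs_def)
  moreover have "card ?T = 4 * card (good_pairs m)"
    using bij_betw_same_card[OF bij_betw_restrict[OF refl, of m]]
    by (simp add: card_cartesian_product card_Pow)
  moreover have "?T = good_pairs (Suc m) \<union> ?B"
    unfolding good_pairs_def by blast
  moreover have "finite ?B"
    by (rule finite_subset[of _ "Pow {1..Suc m} \<times> Pow {1..Suc m}"]) auto
  moreover have "good_pairs (Suc m) \<inter> ?B = {}" unfolding good_pairs_def by blast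
  ultimately show ?thesis using card_Un_disjoint[of "good_pairs (Suc m)" ?B] by simp
qed

lemma num_diag_1: "num_diag 1 = 1"
proof -
  have "good_pairs 0 = {({}, {})}" by (auto simp: good_pairs_def)
  then show ?thesis using num_diag_eq[of 0 0] by simp
qed

text \<open>From odd \<open>k\<close> to \<open>k + 1\<close> the good pairs stay the same and a
  free middle element appears; from even \<open>k\<close> the middle element is lost and
  \<open>m\<close> grows by one.\<close>

lemma num_diag_Suc:
  assumes "0 < k"
  shows "num_diag (Suc k) + (if even k then num_pairs (k div 2) else 0) = 2 * num_diag k"
proof (cases "even k")
  case True
  then obtain j where "k = 2 * j" by (elim evenE)
  with assms obtain m where m: "k = 2 * Suc m" by (cases j) auto
  have "num_diag (Suc k) = card (good_pairs (Suc m))"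
    using num_diag_eq[of 0 "Suc m"] m by simp
  moreover have "num_diag k = 2 * card (good_pairs m)"
    using num_diag_eq[of 1 m] m by simp
  ultimately show ?thesis using card_good_pairs_Suc[of m] m by simp
next
  case False
  then obtain m where "k = 2 * m + 1" by (auto elim: oddE)
  then show ?thesis using num_diag_eq[of 0 m] num_diag_eq[of 1 m] by simp
qed

section \<open>Exponential bounds for the counts\<close>

lemma num_diag_le: "num_diag (Suc n) \<le> 2 ^ n"
proof -
  have "num_diag (Suc n) \<le> card (Pow {0<..<Suc n})"
    unfolding num_diag_def by (rule card_mono) (auto simp: admissible_def)
  then show ?thesis by (simp add: card_Pow)
qed

text \<open>Each element of \<open>A\<close> is in \<open>L\<close>, in \<open>M\<close> but not in
  \<open>L\<close>, or outside \<open>M\<close>; the values 0, 1, 2 record which.\<close>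

lemma card_nested_pairs:
  assumes "finite A"
  shows "card {(L, M). L \<subseteq> M \<and> M \<subseteq> A} \<le> 3 ^ card A"
proof -
  let ?f = "\<lambda>(L, M). \<lambda>x\<in>A. if x \<in> L then 0 else if x \<in> M then 1 else (2::nat)"
  have "inj_on ?f {(L, M). L \<subseteq> M \<and> M \<subseteq> A}"
  proof (rule inj_onI)
    fix p q assume p: "p \<in> {(L, M). L \<subseteq> M \<and> M \<subseteq> A}" and q: "q \<in> {(L, M). L \<subseteq> M \<and> M \<subseteq> A}"
      and eq: "?f p = ?f q"
    obtain L M L' M' where pq: "p = (L, M)" "q = (L', M')" by (cases p, cases q)
    have "(x \<in> L \<longleftrightarrow> x \<in> L') \<and> (x \<in> M \<longleftrightarrow> x \<in> M')" if "x \<in> A" for x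
      using fun_cong[OF eq, of x] that p q pq by (auto split: if_splits)
    then have "L = L'" "M = M'" using p q pq by blast+
    then show "p = q" using pq by simp
  qed
  moreover have "?f ` {(L, M). L \<subseteq> M \<and> M \<subseteq> A} \<subseteq> (\<Pi>\<^sub>E x\<in>A. {0, 1, 2})"
    by (auto simp: PiE_iff split: if_splits)
  moreover have "finite (\<Pi>\<^sub>E x\<in>A. {0, 1, 2::nat})" using assms by (intro finite_PiE) auto
  ultimately have "card {(L, M). L \<subseteq> M \<and> M \<subseteq> A} \<le> card (\<Pi>\<^sub>E x\<in>A. {0, 1, 2::nat})"
    by (rule card_inj_on_le)
  also have "\<dots> = 3 ^ card A" using assms by (simp add: card_PiE flip: numeral_3_eq_3)
  finally show ?thesis .
qed

lemma finite_nested_pairs: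
  assumes "finite A"
  shows "finite {(L, M). L \<subseteq> M \<and> M \<subseteq> A}"
  by (rule finite_subset[of _ "Pow A \<times> Pow A"]) (use assms in auto)

lemma num_pairs_le: "num_pairs (Suc n) \<le> 3 ^ n"
proof -
  have "num_pairs (Suc n) \<le> card {(L, M). L \<subseteq> M \<and> M \<subseteq> {0<..<Suc n}}"
    unfolding num_pairs_def
  proof (rule card_mono)
    show "{(L, M). admissible (Suc n) L M} \<subseteq> {(L, M). L \<subseteq> M \<and> M \<subseteq> {0<..<Suc n}}"
      unfolding admissible_def by blast
  qed (rule finite_nested_pairs, simp)
  also have "\<dots> \<le> 3 ^ n" using card_nested_pairs[of "{0<..<Suc n}"] by simp
  finally show ?thesis .
qed

text \<open>One less than the general bound 3, since \<open>({}, {1})\<close> is nested but offers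
  no witness. This gap yields the strict inequality for \<open>g(1/4)\<close>.\<close>

lemma num_pairs_2: "num_pairs 2 \<le> 2"
proof -
  have "(L, M) \<in> {({}, {}), ({1}, {1})}" if adm: "admissible 2 L M" for L M
  proof -
    have "{0<..<2::nat} = {1}" by auto
    then have "L \<subseteq> M" "M \<subseteq> {1}" using adm by (simp_all add: admissible_def)
    moreover have "L \<noteq> {}" if "M \<noteq> {}" using adm that unfolding admissible_def by blast
    ultimately show ?thesis by (auto simp: subset_singleton_iff)
  qed
  then have "{(L, M). admissible 2 L M} \<subseteq> {({}, {}), ({1}, {1})}" by blast
  then have "num_pairs 2 \<le> card {({}, {}), ({1::nat}, {1::nat})}"
    unfolding num_pairs_def by (rule card_mono[rotated]) simp
  then show ?thesis by simp
qed

section \<open>Radii of convergence and the functional equation\<close>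

lemma fps_conv_radius_geI_power_bound:
  fixes F :: "complex fps"
  assumes "c > 0" and bound: "\<And>n. norm (fps_nth F n) \<le> c ^ n"
  shows "fps_conv_radius F \<ge> ereal (1 / c)"
  unfolding fps_conv_radius_def
proof (rule conv_radius_geI_ex')
  fix r :: real assume r: "0 < r" "ereal r < ereal (1 / c)"
  then have "c * r < 1" using \<open>c > 0\<close> by (simp add: field_simps)
  then have "summable (\<lambda>n. (c * r) ^ n)" using r \<open>c > 0\<close> by (intro summable_geometric) simp
  moreover have "norm (fps_nth F n * of_real r ^ n) \<le> (c * r) ^ n" for n
    using mult_right_mono[OF bound[of n], of "r ^ n"] r
    by (simp add: norm_mult norm_power power_mult_distrib)
  ultimately show "summable (\<lambda>n. fps_nth F n * of_real r ^ n)"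
    by (rule summable_comparison_test'[where N = 0])
qed

lemma fps_conv_radius_f: "fps_conv_radius f_series \<ge> ereal (1 / 2)"
proof (rule fps_conv_radius_geI_power_bound)
  fix n show "norm (fps_nth f_series n) \<le> 2 ^ n"
  proof (cases n)
    case (Suc j)
    have "num_diag (Suc j) \<le> 2 ^ Suc j" using num_diag_le[of j] by simp
    then have "real (num_diag (Suc j)) \<le> 2 ^ Suc j" by (metis of_nat_le_iff of_nat_numeral of_nat_power)
    then show ?thesis using Suc by (simp add: f_series_def)
  qed (simp add: f_series_def)
qed simp

text \<open>The exponent is one below the index because the sum of \<open>3^n / 4^(n+1)\<close> is
  exactly 1, the comparison value at \<open>1/4\<close>.\<close>

lemma norm_g_series: "norm (fps_nth g_series (Suc n)) \<le> 3 ^ n"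
proof -
  have "real (num_pairs (Suc n)) \<le> real (3 ^ n)" using num_pairs_le[of n] by (rule of_nat_mono)
  then show ?thesis by (simp add: g_series_def)
qed

lemma fps_conv_radius_g: "fps_conv_radius g_series \<ge> ereal (1 / 3)"
proof (rule fps_conv_radius_geI_power_bound)
  fix n show "norm (fps_nth g_series n) \<le> 3 ^ n"
  proof (cases n)
    case (Suc j)
    have "(3::real) ^ j \<le> 3 ^ Suc j" by simp
    then show ?thesis using norm_g_series[of j] unfolding Suc by linarith
  qed (simp add: g_series_def)
qed simp

lemma sums_eval_fps:
  fixes F :: "complex fps"
  assumes "norm z < fps_conv_radius F"
  shows "(\<lambda>n. fps_nth F n * z ^ n) sums eval_fps F z"
  using summable_fps[OF assms] by (simp add: eval_fps_def summable_sums)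

text \<open>Since \<open>1/4 < 1/3\<close>, even the closed disc is mapped into the disc of
  convergence of \<open>g\<close>.\<close>

lemma norm_square_in_g_disc:
  fixes z :: complex
  assumes "norm z \<le> 1 / 2"
  shows "ereal (norm (z\<^sup>2)) < fps_conv_radius g_series"
proof -
  have "norm (z\<^sup>2) \<le> (1 / 2)\<^sup>2"
    unfolding norm_power using assms by (intro power_mono) auto
  then have "norm (z\<^sup>2) < 1 / 3" by (simp add: power2_eq_square)
  then have "ereal (norm (z\<^sup>2)) < ereal (1 / 3)" by simp
  then show ?thesis using fps_conv_radius_g by (rule less_le_trans)
qed

text \<open>Multiplying the recurrence by \<open>z^(n+1)\<close> and summing gives
  \<open>f = z (2 f + 1 - g(z^2))\<close>.\<close>

lemma functional_equation:
  fixes z :: complex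
  assumes "norm z < 1 / 2"
  shows "(1 - 2 * z) * eval_fps f_series z = z * (1 - eval_fps g_series (z\<^sup>2))"
proof -
  let ?f = "eval_fps f_series z" and ?g = "eval_fps g_series (z\<^sup>2)"
  \<comment> \<open>\<open>G n\<close> is the coefficient of \<open>z^n\<close> in
    \<open>g(z^2)\<close>.\<close>
  define G where "G n = (if even n then fps_nth g_series (n div 2) else 0)" for n
  have "ereal (norm z) < ereal (1 / 2)" using assms by simp
  then have f: "(\<lambda>n. fps_nth f_series n * z ^ n) sums ?f"
    by (intro sums_eval_fps less_le_trans[OF _ fps_conv_radius_f])
  have "(\<lambda>n. fps_nth g_series n * (z\<^sup>2) ^ n) sums ?g"
    using assms by (intro sums_eval_fps norm_square_in_g_disc) simp
  then have "(\<lambda>n. G (2 * n) * z ^ (2 * n)) sums ?g"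
    by (simp add: G_def power_mult)
  then have g: "(\<lambda>n. G n * z ^ n) sums ?g"
    by (subst (asm) sums_mono_reindex) (auto simp: strict_mono_def G_def elim!: evenE)
  have one: "(\<lambda>n. (if n = 0 then 1 else 0) * z ^ n) sums 1"
  proof -
    have "(\<lambda>n. (if n = 0 then 1 else 0) * z ^ n) = (\<lambda>n. if n = 0 then 1 else 0)" by auto
    then show ?thesis using sums_single[of 0 "\<lambda>_. 1::complex"] by simp
  qed
  \<comment> \<open>The doubling recurrence starts at \<open>n = 1\<close>; as the constant term of
    \<open>f\<close> is 0, the extra 1 at \<open>n = 0\<close> supplies the first
    coefficient.\<close>
  have rec: "fps_nth f_series (Suc n) = 2 * fps_nth f_series n + (if n = 0 then 1 else 0) - G n" for n
  proof (cases "n = 0")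
    case True
    then show ?thesis using num_diag_1 by (simp add: f_series_def g_series_def G_def)
  next
    case False
    \<comment> \<open>For even \<open>n > 0\<close> the index \<open>n div 2\<close> is positive, so
      the constant term of \<open>g_series\<close>, set to 0, is not met.\<close>
    then have "n div 2 = 0 \<Longrightarrow> odd n" by (auto elim!: evenE)
    then have "of_nat (num_diag (Suc n)) + G n
        = of_nat (num_diag (Suc n) + (if even n then num_pairs (n div 2) else 0))"
      by (auto simp: g_series_def G_def)
    also have "\<dots> = 2 * of_nat (num_diag n)"
      using num_diag_Suc[of n] False by simp
    finally show ?thesis using False by (simp add: f_series_def algebra_simps)
  qed
  have "(\<lambda>n. fps_nth f_series (Suc n) * z ^ Suc n) sums ?f"
    using f by (subst sums_Suc_iff) (simp add: f_series_def)
  moreover have "(\<lambda>n. z * (2 * (fps_nth f_series n * z ^ n) + (if n = 0 then 1 else 0) * z ^ n - G n * z ^ n))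
      sums (z * (2 * ?f + 1 - ?g))"
    by (intro sums_mult sums_diff sums_add f g one)
  moreover have "(\<lambda>n. fps_nth f_series (Suc n) * z ^ Suc n) =
      (\<lambda>n. z * (2 * (fps_nth f_series n * z ^ n) + (if n = 0 then 1 else 0) * z ^ n - G n * z ^ n))"
    by (simp add: rec algebra_simps fun_eq_iff)
  ultimately have "?f = z * (2 * ?f + 1 - ?g)" by (metis sums_unique2)
  then show ?thesis by (simp add: algebra_simps)
qed

section \<open>The singularity at 1/2\<close>

text \<open>Termwise comparison with a geometric series of sum 1, strict at one index, gives norm
  below 1.\<close>

lemma g_quarter_neq_1: "eval_fps g_series (1 / 4) \<noteq> 1"
proof -
  let ?a = "\<lambda>n. fps_nth g_series (Suc n) * (1 / 4) ^ Suc n"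
  have "ereal (norm (1 / 4 :: complex)) < fps_conv_radius g_series"
    using norm_square_in_g_disc[of "1 / 2"] by (simp add: power2_eq_square)
  then have "(\<lambda>n. fps_nth g_series n * (1 / 4) ^ n) sums eval_fps g_series (1 / 4)"
    by (rule sums_eval_fps)
  then have g: "?a sums eval_fps g_series (1 / 4)"
    by (subst sums_Suc_iff) (simp add: g_series_def)
  have geo: "(\<lambda>n. (3 / 4) ^ n / 4) sums (1::real)"
    using sums_divide[OF geometric_sums[of "3 / 4 :: real"], of 4] by simp
  have le: "norm (?a n) \<le> (3 / 4) ^ n / 4" for n
    using norm_g_series[of n] by (simp add: norm_mult norm_power norm_divide power_divide field_simps)
  \<comment> \<open>Index 1 is the \<open>z^2\<close> term, at most \<open>2/16\<close> against
    \<open>3/16\<close> in the geometric series.\<close>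
  have "norm (?a 1) \<le> 2 / 16"
    using num_pairs_2 by (simp add: g_series_def norm_mult norm_power norm_divide numeral_2_eq_2)
  then have less: "norm (?a 1) < (3 / 4) ^ 1 / 4" by simp
  have sum: "summable (\<lambda>n. norm (?a n))"
    by (rule summable_comparison_test'[OF sums_summable[OF geo], of 0]) (use le in simp)
  have "norm (eval_fps g_series (1 / 4)) \<le> (\<Sum>n. norm (?a n))"
    using summable_norm[OF sum] sums_unique[OF g] by simp
  also have "\<dots> < (\<Sum>n. (3 / 4) ^ n / 4)"
  proof -
    have "0 < (\<Sum>n. (3 / 4) ^ n / 4 - norm (?a n))"
      using le less by (intro suminf_pos2[of _ 1] summable_diff sum sums_summable[OF geo]) simp_all
    then show ?thesis using suminf_diff[OF sums_summable[OF geo] sum] by simp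
  qed
  also have "\<dots> = 1" using sums_unique[OF geo] by simp
  finally show ?thesis by auto
qed

text \<open>As \<open>z\<close> tends to \<open>1/2\<close> inside the disc, the left side of the
  functional equation would tend to 0, but the right side tends to \<open>(1 - g(1/4)) / 2\<close>,
  which is nonzero.\<close>

lemma no_continuous_extension:
  assumes "open V" "1 / 2 \<in> V" "continuous_on V h"
    and h: "\<And>z. z \<in> V \<Longrightarrow> norm z < 1 / 2 \<Longrightarrow> h z = eval_fps f_series z"
  shows False
proof -
  let ?F = "at (1 / 2) within ball 0 (1 / 2) :: complex filter"
  have "?F \<noteq> bot" by (simp add: trivial_limit_within islimpt_ball)
  have "isCont h (1 / 2)" using assms(1-3) by (simp add: continuous_on_eq_continuous_at)
  then have "(h \<longlongrightarrow> h (1 / 2)) ?F"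
    unfolding isCont_def by (rule tendsto_within_subset) simp
  then have left: "((\<lambda>z. (1 - 2 * z) * h z) \<longlongrightarrow> (1 - 2 * (1 / 2)) * h (1 / 2)) ?F"
    by (intro tendsto_intros)
  have right: "((\<lambda>z. z * (1 - eval_fps g_series (z\<^sup>2)))
      \<longlongrightarrow> 1 / 2 * (1 - eval_fps g_series ((1 / 2)\<^sup>2))) ?F"
  proof -
    have "isCont (eval_fps g_series) ((1 / 2)\<^sup>2)"
      by (intro continuous_eval_fps norm_square_in_g_disc) simp
    then have "((\<lambda>z. eval_fps g_series (z\<^sup>2)) \<longlongrightarrow> eval_fps g_series ((1 / 2)\<^sup>2)) ?F"
      by (rule isCont_tendsto_compose) (intro tendsto_intros)
    then show ?thesis by (intro tendsto_intros)
  qed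
  have "\<forall>\<^sub>F z in ?F. z * (1 - eval_fps g_series (z\<^sup>2)) = (1 - 2 * z) * h z"
  proof -
    have "\<forall>\<^sub>F z in ?F. z \<in> V" using assms(1,2) by (simp add: eventually_at_in_open' eventually_at_topological) blast
    moreover have "\<forall>\<^sub>F z in ?F. z \<in> ball 0 (1 / 2)" by (simp add: eventually_at_filter)
    ultimately show ?thesis by eventually_elim (simp add: h functional_equation)
  qed
  then have "((\<lambda>z. (1 - 2 * z) * h z) \<longlongrightarrow> 1 / 2 * (1 - eval_fps g_series ((1 / 2)\<^sup>2))) ?F"
    by (rule tendsto_cong[THEN iffD1, OF _ right])
  then have "1 / 2 * (1 - eval_fps g_series ((1 / 2)\<^sup>2)) = (1 - 2 * (1 / 2)) * h (1 / 2)"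
    by (rule tendsto_unique[OF \<open>?F \<noteq> bot\<close> _ left])
  then show False using g_quarter_neq_1 by (simp add: power2_eq_square)
qed

text \<open>With a larger radius, the power series itself would be a continuous extension to
  \<open>1/2\<close>.\<close>

lemma fps_conv_radius_f_eq: "fps_conv_radius f_series = ereal (1 / 2)"
proof (rule ccontr)
  assume "\<not> ?thesis"
  with fps_conv_radius_f have "ereal (1 / 2) < fps_conv_radius f_series"
    by (simp add: less_le)
  then have "(1 / 2 :: complex) \<in> eball 0 (fps_conv_radius f_series)" by simp
  then show False
    by (rule no_continuous_extension[OF open_eball _ continuous_on_eval_fps]) (rule refl)
qed

lemma boundary_singularity_f: "boundary_singularity f_series (1 / 2)"
proof -
  have False
    if V: "open V" "1 / 2 \<in> V" "h analytic_on V"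
      and h: "\<forall>z\<in>V \<inter> ball 0 (1 / 2). h z = eval_fps f_series z" for V h
  proof -
    have "continuous_on V h"
      by (rule holomorphic_on_imp_continuous_on[OF analytic_imp_holomorphic[OF V(3)]])
    then show False
      by (rule no_continuous_extension[OF V(1,2)]) (use h in simp)
  qed
  then show ?thesis
    unfolding boundary_singularity_def fps_conv_radius_f_eq eball_ereal by fastforce
qed

section \<open>Transfer of analytic continuations and the final result\<close>

lemma eventually_functional_equation:
  "\<forall>\<^sub>F z in nhds 0. (1 - 2 * z) * eval_fps f_series z = z * (1 - eval_fps g_series (z\<^sup>2))"
proof -
  have "\<forall>\<^sub>F z in nhds 0. z \<in> ball (0::complex) (1 / 2)" by (rule eventually_nhds_in_open) simp_all
  then show ?thesis by eventually_elim (simp add: functional_equation)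
qed

text \<open>The functional equation is solved for either function: for \<open>f\<close> by dividing
  by \<open>1 - 2 z\<close>, nonzero on \<open>U\<close>, and for \<open>g(z^2)\<close> by dividing
  by \<open>z\<close>, with a removable singularity at 0.\<close>

lemma germ_extends_to_f_iff:
  assumes "1 / 2 \<notin> U"
  shows "germ_extends_to (eval_fps f_series) U \<longleftrightarrow> germ_extends_to (\<lambda>z. eval_fps g_series (z\<^sup>2)) U"
proof
  assume "germ_extends_to (eval_fps f_series) U"
  then obtain h where h: "h analytic_on U" "\<forall>\<^sub>F z in nhds 0. h z = eval_fps f_series z"
    by (auto simp: germ_extends_to_def)
  \<comment> \<open>The value at 0 is prescribed so that \<open>k\<close> agrees with
    \<open>g(z^2)\<close> on a full neighborhood of 0.\<close>
  define k where "k z = (if z = 0 then eval_fps g_series 0 else 1 - (1 - 2 * z) * h z / z)" for z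
  have ev: "\<forall>\<^sub>F z in nhds 0. k z = eval_fps g_series (z\<^sup>2)"
    using h(2) eventually_functional_equation
    by eventually_elim (auto simp: k_def field_simps)
  have "k analytic_on {z}" if "z \<in> U" for z
  proof (cases "z = 0")
    case True
    have "(\<lambda>z. eval_fps g_series (z\<^sup>2)) analytic_on {0}"
    proof -
      have "(eval_fps g_series \<circ> (\<lambda>z. z\<^sup>2)) analytic_on {0}"
        using norm_square_in_g_disc[of 0]
        by (intro analytic_on_compose analytic_intros analytic_on_eval_fps) auto
      then show ?thesis by (simp add: o_def)
    qed
    then show ?thesis unfolding True by (rule analytic_at_cong[OF ev refl, THEN iffD2])
  next
    case False
    have "h analytic_on {z}" using h(1) that analytic_on_analytic_at by blast
    then have "(\<lambda>z. 1 - (1 - 2 * z) * h z / z) analytic_on {z}"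
      using False by (auto intro!: analytic_intros)
    moreover have "\<forall>\<^sub>F w in nhds z. k w = 1 - (1 - 2 * w) * h w / w"
      using t1_space_nhds[OF False] by eventually_elim (simp add: k_def)
    ultimately show ?thesis by (simp add: analytic_at_cong)
  qed
  then have "k analytic_on U" using analytic_on_analytic_at by blast
  with ev show "germ_extends_to (\<lambda>z. eval_fps g_series (z\<^sup>2)) U"
    by (auto simp: germ_extends_to_def)
next
  assume "germ_extends_to (\<lambda>z. eval_fps g_series (z\<^sup>2)) U"
  then obtain k where k: "k analytic_on U" "\<forall>\<^sub>F z in nhds 0. k z = eval_fps g_series (z\<^sup>2)"
    by (auto simp: germ_extends_to_def)
  have nz: "1 - 2 * z \<noteq> 0" if "z \<noteq> 1 / 2" for z :: complex
    using that by (metis eq_iff_diff_eq_0 mult.commute nonzero_eq_divide_eq zero_neq_numeral)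
  have "(\<lambda>z. z * (1 - k z) / (1 - 2 * z)) analytic_on U"
    by (intro analytic_intros k(1) nz) (use assms in blast)
  moreover have "\<forall>\<^sub>F z in nhds (0::complex). z \<noteq> 1 / 2" by (rule t1_space_nhds) simp
  with k(2) eventually_functional_equation
  have "\<forall>\<^sub>F z in nhds 0. z * (1 - k z) / (1 - 2 * z) = eval_fps f_series z"
  proof eventually_elim
    case (elim z)
    then show ?case using nz[of z] by (simp add: divide_eq_eq mult.commute)
  qed
  ultimately show "germ_extends_to (eval_fps f_series) U"
    unfolding germ_extends_to_def by blast
qed

theorem corollary13:
  shows "boundary_singularity f_series (1/2)
    \<and> fps_conv_radius f_series = ereal (1/2)
    \<and> (\<forall>U. open U \<and> connected U \<and> 0 \<in> U \<and> 1/2 \<notin> U \<longrightarrow>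
          (germ_extends_to (eval_fps f_series) U \<longleftrightarrow>
           germ_extends_to (\<lambda>z. eval_fps g_series (z\<^sup>2)) U))
    \<and> (\<exists>h. continuous_on (cball 0 (1/2)) h \<and>
          (\<forall>z::complex. norm z < 1/2 \<longrightarrow> h z = eval_fps f_series z * (z - 1/2)))"
proof (intro conjI)
  \<comment> \<open>This is the right side of the functional equation divided by -2, as
    \<open>z - 1/2 = -(1 - 2 z) / 2\<close>.\<close>
  let ?h = "\<lambda>z. z * (eval_fps g_series (z\<^sup>2) - 1) / 2"
  have "continuous_on (cball 0 (1/2)) ?h"
    using norm_square_in_g_disc by (intro continuous_intros) (auto simp: subset_iff)
  moreover have "?h z = eval_fps f_series z * (z - 1/2)" if "norm z < 1/2" for z
  proof -
    have "eval_fps f_series z * (z - 1/2) = - ((1 - 2 * z) * eval_fps f_series z) / 2"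
      by (simp add: field_simps)
    also have "\<dots> = ?h z" unfolding functional_equation[OF that] by (simp add: field_simps)
    finally show ?thesis by simp
  qed
  ultimately show "\<exists>h. continuous_on (cball 0 (1/2)) h \<and>
      (\<forall>z::complex. norm z < 1/2 \<longrightarrow> h z = eval_fps f_series z * (z - 1/2))"
    by blast
qed (simp_all add: boundary_singularity_f fps_conv_radius_f_eq germ_extends_to_f_iff)

end
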